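(* Let $f:(\Sigma^2,\frac1\mu)\to\mathbb{H}$ be a discrete isothermic surface with one family of periodic curvature lines. If $\hat f:(\Sigma^2,\frac1\mu)\to\mathbb{H}$ is a Darboux transform of $f$, then the corresponding family of curvature lines of $\hat f$ is also periodic with the same period if and only if one of the curvature lines of this corresponding family is periodic (with that same period). Explicitly, if say the $m$-curvature lines of $f$ are periodic, $f_{m+M,n}=f_{m,n}$ for all $(m,n)$ with some $M\in\mathbb{N}$, then $\hat f_{m+M,n}=\hat f_{m,n}$ for all $(m,n)$ if and only if there is some fixed $n_0$ with $\hat f_{m+M,n_0}=\hat f_{m,n_0}$ for all $m$.
   Context: $\mathbb{H}$ denotes the quaternions. $\Sigma^2=\Sigma^1\times\tilde\Sigma^1\subset\mathbb{Z}^2$ is a discrete rectangular domain, with $\Sigma^1,\tilde\Sigma^1\subset\mathbb{Z}$ simply connected (intervals of consecutive integers). For a function $f$ on $\Sigma^2$ write $f_{m,n}=f(m,n)$ and $f_i=f(i)$. An elementary quadrilateral $(ijk\ell)$ has vertices $i=(m,n)$, $j=(m+1,n)$, $k=(m+1,n+1)$, $\ell=(m,n+1)$. The cross-ratio of four quaternions is $$\mathrm{cr}(a,b,c,d)=(a-b)(b-c)^{-1}(c-d)(d-a)^{-1}.$$ A discrete surface $f:\Sigma^2\to\mathbb{H}$ is discrete isothermic if on every elementary quadrilateral $\mathrm{cr}(f_i,f_j,f_k,f_\ell)=\mu_{i\ell}/\mu_{ij}$ for some real function $\mu$ on unoriented edges (the cross-ratios factorising function) with the edge-labelling property $\mu_{ij}=\mu_{k\ell}$,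 $\mu_{i\ell}=\mu_{jk}$. Regarding $\mu$ as a polarisation of the domain, one writes $f:(\Sigma^2,\frac1\mu)\to\mathbb{H}$. The $m$-curvature lines of $f$ are the discrete curves $m\mapsto f_{m,n_0}$ ($n_0$ fixed) and the $n$-curvature lines are $n\mapsto f_{m_0,n}$ ($m_0$ fixed). A Darboux transform of $f$ with spectral parameter $\nu\in\mathbb{R}$ is a discrete surface $\hat f:\Sigma^2\to\mathbb{H}$ such that $\mathrm{cr}(f_i,f_j,\hat f_j,\hat f_i)=\nu/\mu_{ij}$ on every edge $(ij)$ (in either direction); it is discrete isothermic with the same cross-ratios factorising function $\mu$.
   Formalization: The formal theorem additionally assumes that the spectral parameter ν differs from μ on all edges transversal to the periodic curvature lines; if ν = μ there, the prescribed cross-ratio is 1 and the claim can fail. *)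

theory Defs
  imports Complex_Main
begin

datatype quat = Quat (qre: real) (qi: real) (qj: real) (qk: real)

lemma quat_eq_iff:
  "p = q \<longleftrightarrow> qre p = qre q \<and> qi p = qi q \<and> qj p = qj q \<and> qk p = qk q"
  by (cases p; cases q) auto

instantiation quat :: real_div_algebra
begin

definition zero_quat :: quat where
  "0 = Quat 0 0 0 0"

definition one_quat :: quat where
  "1 = Quat 1 0 0 0"

definition plus_quat :: "quat \<Rightarrow> quat \<Rightarrow> quat" where
  "p + q = Quat (qre p + qre q) (qi p + qi q) (qj p + qj q) (qk p + qk q)"

definition uminus_quat :: "quat \<Rightarrow> quat" where
  "- p = Quat (- qre p) (- qi p) (- qj p) (- qk p)"

definition minus_quat :: "quat \<Rightarrow> quat \<Rightarrow> quat" where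
  "p - q = Quat (qre p - qre q) (qi p - qi q) (qj p - qj q) (qk p - qk q)"

definition times_quat :: "quat \<Rightarrow> quat \<Rightarrow> quat" where
  "p * q = Quat
     (qre p * qre q - qi p * qi q - qj p * qj q - qk p * qk q)
     (qre p * qi q + qi p * qre q + qj p * qk q - qk p * qj q)
     (qre p * qj q - qi p * qk q + qj p * qre q + qk p * qi q)
     (qre p * qk q + qi p * qj q - qj p * qi q + qk p * qre q)"

definition scaleR_quat :: "real \<Rightarrow> quat \<Rightarrow> quat" where
  "scaleR r p = Quat (r * qre p) (r * qi p) (r * qj p) (r * qk p)"

definition inverse_quat :: "quat \<Rightarrow> quat" where
  "inverse p =
     (let N = (qre p)\<^sup>2 + (qi p)\<^sup>2 + (qj p)\<^sup>2 + (qk p)\<^sup>2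
      in Quat (qre p / N) (- qi p / N) (- qj p / N) (- qk p / N))"

definition divide_quat :: "quat \<Rightarrow> quat \<Rightarrow> quat" where
  "p div q = p * inverse (q :: quat)"

lemmas quat_defs = zero_quat_def one_quat_def plus_quat_def uminus_quat_def
  minus_quat_def times_quat_def scaleR_quat_def

lemma quat_norm_sq_neq_0:
  assumes "(p :: quat) \<noteq> 0"
  shows "(qre p)\<^sup>2 + (qi p)\<^sup>2 + (qj p)\<^sup>2 + (qk p)\<^sup>2 \<noteq> 0"
proof
  assume h: "(qre p)\<^sup>2 + (qi p)\<^sup>2 + (qj p)\<^sup>2 + (qk p)\<^sup>2 = 0"
  have "(qre p)\<^sup>2 \<ge> 0" "(qi p)\<^sup>2 \<ge> 0" "(qj p)\<^sup>2 \<ge> 0" "(qk p)\<^sup>2 \<ge> 0"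
    by simp_all
  with h have "(qre p)\<^sup>2 = 0" "(qi p)\<^sup>2 = 0" "(qj p)\<^sup>2 = 0" "(qk p)\<^sup>2 = 0"
    by linarith+
  with assms show False
    by (simp add: quat_eq_iff zero_quat_def)
qed

instance
proof
  fix p q r :: quat and x y :: real
  show "p + q + r = p + (q + r)" "p + q = q + p" "0 + p = p" "- p + p = 0" "p - q = p + - q"
    by (simp_all add: quat_defs)
  show "x *\<^sub>R (p + q) = x *\<^sub>R p + x *\<^sub>R q" "(x + y) *\<^sub>R p = x *\<^sub>R p + y *\<^sub>R p"
    "x *\<^sub>R y *\<^sub>R p = (x * y) *\<^sub>R p" "1 *\<^sub>R p = p"
    "x *\<^sub>R p * q = x *\<^sub>R (p * q)" "p * x *\<^sub>R q = x *\<^sub>R (p * q)"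
    by (simp_all add: quat_defs algebra_simps)
  show "p * q * r = p * (q * r)" "(p + q) * r = p * r + q * r" "p * (q + r) = p * q + p * r"
    "1 * p = p" "p * 1 = p" "(0 :: quat) \<noteq> 1"
    by (simp_all add: quat_defs algebra_simps)
  show "inverse (0 :: quat) = 0"
    by (simp add: inverse_quat_def zero_quat_def)
  show "p div q = p * inverse q"
    by (simp add: divide_quat_def)
  assume "p \<noteq> 0"
  define N where "N = (qre p)\<^sup>2 + (qi p)\<^sup>2 + (qj p)\<^sup>2 + (qk p)\<^sup>2"
  have N: "N \<noteq> 0"
    using quat_norm_sq_neq_0[OF \<open>p \<noteq> 0\<close>] by (simp add: N_def)
  have i: "inverse p = Quat (qre p / N) (- qi p / N) (- qj p / N) (- qk p / N)"
    by (simp add: inverse_quat_def N_def Let_def)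
  have e: "qre p * qre p + qi p * qi p + qj p * qj p + qk p * qk p = N"
    by (simp add: N_def power2_eq_square)
  show "inverse p * p = 1" "p * inverse p = 1"
    unfolding i using N e by (simp_all add: quat_defs field_simps)
qed

end

text \<open>
  With the convention \<open>inverse 0 = 0\<close> the cross-ratio is a total function, so \<open>has_cr\<close> adds
  that the two factors being inverted are nonzero.
\<close>

definition cr :: "quat \<Rightarrow> quat \<Rightarrow> quat \<Rightarrow> quat \<Rightarrow> quat" where
  "cr a b c d = (a - b) * inverse (b - c) * (c - d) * inverse (d - a)"

definition has_cr :: "quat \<Rightarrow> quat \<Rightarrow> quat \<Rightarrow> quat \<Rightarrow> real \<Rightarrow> bool" where
  "has_cr a b c d r \<longleftrightarrow> b \<noteq> c \<and> d \<noteq> a \<and> cr a b c d = of_real r"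

definition int_interval :: "int set \<Rightarrow> bool" where
  "int_interval S \<longleftrightarrow> S \<noteq> {} \<and> (\<forall>a\<in>S. \<forall>b\<in>S. {a..b} \<subseteq> S)"

text \<open>
  An unoriented edge is the two-element set of its end points; functions on unoriented edges
  have type \<open>(int \<times> int) set \<Rightarrow> real\<close>.
\<close>

definition m_edges :: "(int \<times> int) set \<Rightarrow> (int \<times> int) set set" where
  "m_edges D = {{(m, n), (m + 1, n)} | m n. (m, n) \<in> D \<and> (m + 1, n) \<in> D}"

definition n_edges :: "(int \<times> int) set \<Rightarrow> (int \<times> int) set set" where
  "n_edges D = {{(m, n), (m, n + 1)} | m n. (m, n) \<in> D \<and> (m, n + 1) \<in> D}"

definition edges :: "(int \<times> int) set \<Rightarrow> (int \<times> int) set set" where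
  "edges D = m_edges D \<union> n_edges D"

definition discrete_isothermic ::
  "(int \<times> int) set \<Rightarrow> ((int \<times> int) set \<Rightarrow> real) \<Rightarrow> (int \<times> int \<Rightarrow> quat) \<Rightarrow> bool" where
  "discrete_isothermic D \<mu> f \<longleftrightarrow>
     (\<forall>e\<in>edges D. \<mu> e \<noteq> 0) \<and>
     (\<forall>m n. let i = (m, n); j = (m + 1, n); k = (m + 1, n + 1); l = (m, n + 1) in
        {i, j, k, l} \<subseteq> D \<longrightarrow>
          \<mu> {i, j} = \<mu> {k, l} \<and> \<mu> {i, l} = \<mu> {j, k} \<and>
          has_cr (f i) (f j) (f k) (f l) (\<mu> {i, l} / \<mu> {i, j}))"

text \<open>Since \<open>{i, j} = {j, i}\<close>, both orientations of every edge are covered.\<close>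

definition darboux_transform ::
  "(int \<times> int) set \<Rightarrow> ((int \<times> int) set \<Rightarrow> real) \<Rightarrow> real \<Rightarrow>
     (int \<times> int \<Rightarrow> quat) \<Rightarrow> (int \<times> int \<Rightarrow> quat) \<Rightarrow> bool" where
  "darboux_transform D \<mu> \<nu> f g \<longleftrightarrow>
     (\<forall>i j. {i, j} \<in> edges D \<longrightarrow> has_cr (f i) (f j) (g j) (g i) (\<nu> / \<mu> {i, j}))"

definition m_curvature_line :: "(int \<times> int \<Rightarrow> quat) \<Rightarrow> int \<Rightarrow> int \<Rightarrow> quat" where
  "m_curvature_line f n\<^sub>0 = (\<lambda>m. f (m, n\<^sub>0))"

definition n_curvature_line :: "(int \<times> int \<Rightarrow> quat) \<Rightarrow> int \<Rightarrow> int \<Rightarrow> quat" where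
  "n_curvature_line f m\<^sub>0 = (\<lambda>n. f (m\<^sub>0, n))"

text \<open>
  The identity is required wherever both sides lie in the domain \<open>S\<close> of the curve, which for
  \<open>S = UNIV\<close> is the usual notion of a period.
\<close>

definition periodic_on :: "int set \<Rightarrow> nat \<Rightarrow> (int \<Rightarrow> quat) \<Rightarrow> bool" where
  "periodic_on S M c \<longleftrightarrow> (\<forall>m. m \<in> S \<and> m + int M \<in> S \<longrightarrow> c (m + int M) = c m)"

text \<open>
  If \<open>\<nu> = \<mu> {i, j}\<close>, the condition on the edge \<open>{i, j}\<close> prescribes the cross-ratio \<open>1\<close>, which is
  attained exactly when \<open>f i = g j\<close> or \<open>f j = g i\<close>, and then the value of \<open>g\<close> at one end point
  need not determine the value at the other. For instance, \<open>g (m, n\<^sub>0) = f (m, n\<^sub>0 + 1)\<close> for all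
  \<open>m\<close> is compatible with any admissible initial value for the curve \<open>g (m, n\<^sub>0 + 1)\<close>. The following
  predicate excludes this resonance on a given set of edges.
\<close>

definition nonresonant :: "((int \<times> int) set \<Rightarrow> real) \<Rightarrow> real \<Rightarrow> (int \<times> int) set set \<Rightarrow> bool" where
  "nonresonant \<mu> \<nu> E \<longleftrightarrow> (\<forall>e\<in>E. \<nu> \<noteq> \<mu> e)"

end

(*
  On an edge the Darboux condition prescribes the cross-ratio of f_i, f_j, g_j, g_i, and unless this
  value is 1 the three points f_i, f_j, g_i determine g_j. Edges that are translates of each other by
  the period carry the same values of f and, by the edge-labelling property, the same cross-ratio, so
  the periodicity of g passes from one curvature line to the neighbouring ones.
*)

theory Submission
  imports Defs
begin

text \<open>An integer interval has no gaps, so a property that crosses each unit step in both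
  directions spreads from one member to all others, above and below.\<close>

lemma int_interval_induct:
  assumes "int_interval T" "a \<in> T" "b \<in> T" "P a"
    and step: "\<And>n. n \<in> T \<Longrightarrow> n + 1 \<in> T \<Longrightarrow> P n \<longleftrightarrow> P (n + 1)"
  shows "P b"
proof -
  have sub: "n \<in> T" if "x \<in> T" "y \<in> T" "x \<le> n" "n \<le> y" for n x y
    using assms(1) that unfolding int_interval_def by (meson atLeastAtMost_iff subsetD)
  have "b \<in> T \<longrightarrow> P b"
  proof (induction b rule: int_induct[where k = a])
    case base
    then show ?case using assms by simp
  next
    case (step1 i)
    then show ?case using sub[of a "i + 1" i] step[of i] \<open>a \<in> T\<close> by auto
  next
    case (step2 i)
    then show ?case using sub[of "i - 1" a i] step[of "i - 1"] \<open>a \<in> T\<close> by auto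
  qed
  then show ?thesis using \<open>b \<in> T\<close> by simp
qed

text \<open>
  Since \<open>c - d = (b - d) - (b - c)\<close>, the cross-ratio condition is affine in \<open>inverse (b - c)\<close>,
  with coefficient \<open>b - d\<close>; this vanishes only for the value \<open>1\<close>.
\<close>

lemma has_cr_unique:
  assumes "has_cr a b c d r" "has_cr a b c' d r" "a \<noteq> b" "r \<noteq> 1"
  shows "c = c'"
proof -
  \<comment> \<open>\<open>x\<close> stands for \<open>c\<close> and for \<open>c'\<close>.
    Quaternions do not commute, so \<open>a - b\<close> is cancelled on the left and
    \<open>d - a\<close> on the right; the resulting right-hand side is free of
    \<open>x\<close>.\<close>
  have expand: "inverse (b - x) * (b - d) = 1 + inverse (a - b) * (of_real r * (d - a))"
    if "has_cr a b x d r" for x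
  proof -
    from that have ne: "b - x \<noteq> 0" "d - a \<noteq> 0"
      and e: "(a - b) * inverse (b - x) * (x - d) * inverse (d - a) = of_real r"
      by (auto simp: has_cr_def cr_def)
    have "(a - b) * (inverse (b - x) * (x - d)) = of_real r * (d - a)"
      using e ne(2) by (metis mult.assoc left_inverse mult.right_neutral)
    then have "inverse (b - x) * (x - d) = inverse (a - b) * (of_real r * (d - a))"
      using \<open>a \<noteq> b\<close> by (metis mult.assoc left_inverse mult_1 right_minus_eq)
    moreover have "inverse (b - x) * (x - d) = inverse (b - x) * (b - d) - 1"
      using ne(1) right_diff_distrib[of "inverse (b - x)" "b - d" "b - x"] by simp
    ultimately show ?thesis by (simp add: diff_eq_eq add.commute)
  qed
  have "b \<noteq> d"
  proof
    assume "b = d"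
    then have "0 = 1 + inverse (a - b) * (of_real r * - (a - b))"
      using expand[OF assms(1)] by simp
    \<comment> \<open>Real scalars are central, so \<open>w\<close> cancels against its inverse
      across \<open>of_real r\<close>.\<close>
    moreover have "inverse w * (of_real r * - w) = - of_real r" if "w \<noteq> 0" for w :: quat
      using that by (simp add: of_real_def)
    ultimately have "0 = 1 + - (of_real r :: quat)"
      using \<open>a \<noteq> b\<close> by (metis right_minus_eq)
    then have "of_real r = (of_real 1 :: quat)" by simp
    with \<open>r \<noteq> 1\<close> show False by (simp only: of_real_eq_iff)
  qed
  moreover have "inverse (b - c) * (b - d) = inverse (b - c') * (b - d)"
    using assms(1,2) by (simp add: expand)
  ultimately have "inverse (b - c) = inverse (b - c')" by simp
  then show ?thesis by simp
qed

text \<open>Both \<open>g y\<close> and \<open>g y'\<close> complete the same three points to the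
  same cross-ratio, which differs from 1 because \<nu> differs from the edge label. Edges are
  unordered, so either end point can play the role of \<open>x\<close>.\<close>

lemma darboux_transform_edge_unique:
  assumes "darboux_transform D \<mu> \<nu> f g" "{x, y} \<in> edges D" "{x', y'} \<in> edges D"
    and "f x' = f x" "f y' = f y" "\<mu> {x', y'} = \<mu> {x, y}"
    and "f x \<noteq> f y" "\<nu> \<noteq> \<mu> {x, y}" "g x' = g x"
  shows "g y' = g y"
proof -
  have "has_cr (f x) (f y) (g y) (g x) (\<nu> / \<mu> {x, y})"
    "has_cr (f x) (f y) (g y') (g x) (\<nu> / \<mu> {x, y})"
    using assms(1-6,9) unfolding darboux_transform_def by metis+
  with assms(7,8) show ?thesis
    using has_cr_unique[of "f x" "f y" "g y'" "g x" _ "g y"] by simp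
qed

text \<open>
  The map \<open>p\<close> lists the vertices of the domain so that the first argument runs along the curvature
  lines under consideration, which covers both families at once.
\<close>

lemma darboux_transform_periodic_iff:
  fixes p :: "int \<Rightarrow> int \<Rightarrow> int \<times> int"
  assumes S: "int_interval S" and T: "int_interval T" and "0 < M"
    and dt: "darboux_transform D \<mu> \<nu> f g"
    and edge: "\<And>s t. s \<in> S \<Longrightarrow> t \<in> T \<Longrightarrow> t + 1 \<in> T \<Longrightarrow> {p s t, p s (t + 1)} \<in> edges D"
    and nonres: "\<And>s t. s \<in> S \<Longrightarrow> t \<in> T \<Longrightarrow> t + 1 \<in> T \<Longrightarrow> \<nu> \<noteq> \<mu> {p s t, p s (t + 1)}"
    and lab: "\<And>s t. s \<in> S \<Longrightarrow> s + 1 \<in> S \<Longrightarrow> t \<in> T \<Longrightarrow> t + 1 \<in> T \<Longrightarrow>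
      \<mu> {p s t, p s (t + 1)} = \<mu> {p (s + 1) t, p (s + 1) (t + 1)}"
    and dist: "\<And>s t. s \<in> S \<Longrightarrow> s + 1 \<in> S \<Longrightarrow> t \<in> T \<Longrightarrow> t + 1 \<in> T \<Longrightarrow> f (p s t) \<noteq> f (p s (t + 1))"
    and per: "\<forall>t\<in>T. periodic_on S M (\<lambda>s. f (p s t))"
  shows "(\<forall>t\<in>T. periodic_on S M (\<lambda>s. g (p s t))) \<longleftrightarrow> (\<exists>t\<in>T. periodic_on S M (\<lambda>s. g (p s t)))"
proof
  \<comment> \<open>An \<open>int_interval\<close> is nonempty, which supplies the witness.\<close>
  assume "\<forall>t\<in>T. periodic_on S M (\<lambda>s. g (p s t))"
  then show "\<exists>t\<in>T. periodic_on S M (\<lambda>s. g (p s t))"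
    using T by (auto simp: int_interval_def)
next
  have step: "g (p (s + int M) t) = g (p s t) \<longleftrightarrow> g (p (s + int M) (t + 1)) = g (p s (t + 1))"
    if s: "s \<in> S" "s + int M \<in> S" and t: "t \<in> T" "t + 1 \<in> T" for s t
  proof -
    let ?s' = "s + int M"
    \<comment> \<open>Distinctness of the values of \<open>f\<close> on a transverse edge is read
      off a quadrilateral, so \<open>dist\<close> asks for the neighbour \<open>s + 1\<close>; a
      positive period places it between \<open>s\<close> and \<open>s + int M\<close>.\<close>
    have "s + 1 \<in> {s..?s'}" using \<open>0 < M\<close> by simp
    with S s have s1: "s + 1 \<in> S" unfolding int_interval_def by blast
    have f: "f (p ?s' t) = f (p s t)" "f (p ?s' (t + 1)) = f (p s (t + 1))"
      using per s t by (auto simp: periodic_on_def)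
    \<comment> \<open>The label of a transverse edge is carried from \<open>s\<close> to
      \<open>s + int M\<close> by \<open>lab\<close>, one quadrilateral at a time.\<close>
    have \<mu>: "\<mu> {p ?s' t, p ?s' (t + 1)} = \<mu> {p s t, p s (t + 1)}"
      by (rule int_interval_induct[OF S s, where
            P = "\<lambda>r. \<mu> {p r t, p r (t + 1)} = \<mu> {p s t, p s (t + 1)}"]) (use lab t in auto)
    note e = edge[OF s(1) t] edge[OF s(2) t] and n = nonres[OF s(1) t] and d = dist[OF s(1) s1 t]
    \<comment> \<open>The first instance passes from \<open>t\<close> to \<open>t + 1\<close>; the
      second exchanges the end points of both edges and passes back.\<close>
    show ?thesis
      using darboux_transform_edge_unique[OF dt e f \<mu> d n]
        darboux_transform_edge_unique[OF dt e[unfolded insert_commute[of "p _ t"]] f(2,1)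
          \<mu>[unfolded insert_commute[of "p _ t"]] d[symmetric] n[unfolded insert_commute[of "p _ t"]]]
      by blast
  qed
  assume "\<exists>t\<in>T. periodic_on S M (\<lambda>s. g (p s t))"
  then obtain t\<^sub>0 where t0: "t\<^sub>0 \<in> T" "periodic_on S M (\<lambda>s. g (p s t\<^sub>0))" by blast
  show "\<forall>t\<in>T. periodic_on S M (\<lambda>s. g (p s t))"
  proof
    fix t assume "t \<in> T"
    show "periodic_on S M (\<lambda>s. g (p s t))"
      by (rule int_interval_induct[OF T t0(1) \<open>t \<in> T\<close>, where
            P = "\<lambda>t. periodic_on S M (\<lambda>s. g (p s t))"])
         (use t0(2) step in \<open>auto simp: periodic_on_def\<close>)
  qed
qed

text \<open>Supplies \<open>lab\<close> and \<open>dist\<close> of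
  \<open>darboux_transform_periodic_iff\<close> for both families of curvature lines.\<close>

lemma discrete_isothermic_quad:
  assumes "discrete_isothermic (S \<times> T) \<mu> f" "m \<in> S" "m + 1 \<in> S" "n \<in> T" "n + 1 \<in> T"
  shows "\<mu> {(m, n), (m + 1, n)} = \<mu> {(m, n + 1), (m + 1, n + 1)}"
    and "\<mu> {(m, n), (m, n + 1)} = \<mu> {(m + 1, n), (m + 1, n + 1)}"
    and "f (m, n) \<noteq> f (m + 1, n)" and "f (m, n) \<noteq> f (m, n + 1)"
proof -
  let ?h = "{(m, n), (m + 1, n)}" and ?v = "{(m, n), (m, n + 1)}"
  have "?h \<in> edges (S \<times> T)" "?v \<in> edges (S \<times> T)"
    using assms(2-5) by (auto simp: edges_def m_edges_def n_edges_def)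
  then have nz: "\<mu> ?h \<noteq> 0" "\<mu> ?v \<noteq> 0"
    using assms(1) by (auto simp: discrete_isothermic_def)
  have q: "\<mu> ?h = \<mu> {(m + 1, n + 1), (m, n + 1)} \<and> \<mu> ?v = \<mu> {(m + 1, n), (m + 1, n + 1)} \<and>
      has_cr (f (m, n)) (f (m + 1, n)) (f (m + 1, n + 1)) (f (m, n + 1)) (\<mu> ?v / \<mu> ?h)"
    using assms unfolding discrete_isothermic_def Let_def by blast
  then show "\<mu> ?h = \<mu> {(m, n + 1), (m + 1, n + 1)}" "\<mu> ?v = \<mu> {(m + 1, n), (m + 1, n + 1)}"
    by (simp_all add: insert_commute)
  \<comment> \<open>The factor \<open>a - b\<close> is not inverted, so a nonzero cross-ratio forces
    it to be nonzero; \<open>has_cr\<close> itself covers \<open>d - a\<close>.\<close>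
  have "a \<noteq> b \<and> a \<noteq> d" if "has_cr a b c d r" "r \<noteq> 0" for a b c d r
    using that by (auto simp: has_cr_def cr_def)
  then show "f (m, n) \<noteq> f (m + 1, n)" "f (m, n) \<noteq> f (m, n + 1)"
    using q nz by (meson divide_eq_0_iff)+
qed

theorem theorem3p5:
  fixes S T :: "int set"
    and \<mu> :: "(int \<times> int) set \<Rightarrow> real"
    and \<nu> :: real
    and f g :: "int \<times> int \<Rightarrow> quat"
  assumes "int_interval S" and "int_interval T"
    and "discrete_isothermic (S \<times> T) \<mu> f"
    and "darboux_transform (S \<times> T) \<mu> \<nu> f g"
  shows
    "(\<forall>M::nat. 0 < M \<longrightarrow> nonresonant \<mu> \<nu> (n_edges (S \<times> T)) \<longrightarrow>
        (\<forall>n\<in>T. periodic_on S M (m_curvature_line f n)) \<longrightarrow>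
        ((\<forall>n\<in>T. periodic_on S M (m_curvature_line g n)) \<longleftrightarrow>
         (\<exists>n\<^sub>0\<in>T. periodic_on S M (m_curvature_line g n\<^sub>0)))) \<and>
     (\<forall>N::nat. 0 < N \<longrightarrow> nonresonant \<mu> \<nu> (m_edges (S \<times> T)) \<longrightarrow>
        (\<forall>m\<in>S. periodic_on T N (n_curvature_line f m)) \<longrightarrow>
        ((\<forall>m\<in>S. periodic_on T N (n_curvature_line g m)) \<longleftrightarrow>
         (\<exists>m\<^sub>0\<in>S. periodic_on T N (n_curvature_line g m\<^sub>0))))"
proof (intro conjI allI impI)
  note quad = discrete_isothermic_quad[OF assms(3)]
  fix M :: nat
  assume "0 < M" and nonres: "nonresonant \<mu> \<nu> (n_edges (S \<times> T))"
    and per: "\<forall>n\<in>T. periodic_on S M (m_curvature_line f n)"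
  show "(\<forall>n\<in>T. periodic_on S M (m_curvature_line g n)) \<longleftrightarrow>
      (\<exists>n\<^sub>0\<in>T. periodic_on S M (m_curvature_line g n\<^sub>0))"
    unfolding m_curvature_line_def
  \<comment> \<open>Here \<open>p m n\<close> is \<open>(m, n)\<close>: neighbouring lines are
    joined by edges in the n-direction, which is where nonresonance enters.\<close>
  proof (rule darboux_transform_periodic_iff[OF assms(1,2) \<open>0 < M\<close> assms(4)])
    fix m n assume mn: "m \<in> S" "n \<in> T" "n + 1 \<in> T"
    then have e: "{(m, n), (m, n + 1)} \<in> n_edges (S \<times> T)"
      by (auto simp: n_edges_def)
    then show "{(m, n), (m, n + 1)} \<in> edges (S \<times> T)" by (simp add: edges_def)
    show "\<nu> \<noteq> \<mu> {(m, n), (m, n + 1)}" using nonres e unfolding nonresonant_def by blast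
  qed (use per quad in \<open>auto simp: m_curvature_line_def\<close>)
next
  note quad = discrete_isothermic_quad[OF assms(3)]
  fix N :: nat
  assume "0 < N" and nonres: "nonresonant \<mu> \<nu> (m_edges (S \<times> T))"
    and per: "\<forall>m\<in>S. periodic_on T N (n_curvature_line f m)"
  show "(\<forall>m\<in>S. periodic_on T N (n_curvature_line g m)) \<longleftrightarrow>
      (\<exists>m\<^sub>0\<in>S. periodic_on T N (n_curvature_line g m\<^sub>0))"
    unfolding n_curvature_line_def
  \<comment> \<open>The roles are exchanged: \<open>p n m\<close> is \<open>(m, n)\<close>, with
    \<open>n\<close> running along the curves and \<open>m\<close> across them.\<close>
  proof (rule darboux_transform_periodic_iff[OF assms(2,1) \<open>0 < N\<close> assms(4)])
    fix n m assume mn: "n \<in> T" "m \<in> S" "m + 1 \<in> S"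
    then have e: "{(m, n), (m + 1, n)} \<in> m_edges (S \<times> T)"
      by (auto simp: m_edges_def)
    then show "{(m, n), (m + 1, n)} \<in> edges (S \<times> T)" by (simp add: edges_def)
    show "\<nu> \<noteq> \<mu> {(m, n), (m + 1, n)}" using nonres e unfolding nonresonant_def by blast
  qed (use per quad in \<open>auto simp: n_curvature_line_def\<close>)
qed

end
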